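(* $SI_\cap^{*}$, $I_\cap^{\wedge}$ and $I_\cap^{\mathrm{GH}}$ are not continuous. That is, for each of the three shared information functions $SI_\cap^{*}$, $SI_\cap^{\wedge}$, $SI_\cap^{\mathrm{GH}}$ there exist finite sets $\mathcal S,\mathcal Y,\mathcal Z$ such that the function $P\mapsto SI(S;Y,Z)$ on the probability simplex of all joint distributions $P$ of $(S,Y,Z)$ on $\mathcal S\times\mathcal Y\times\mathcal Z$ is not continuous.
   Context: $S,Y,Z$ are random variables with finite state spaces $\mathcal S,\mathcal Y,\mathcal Z$ and joint distribution $P$. Continuity is with respect to the canonical (Euclidean) topology of the probability simplex over $\mathcal S\times\mathcal Y\times\mathcal Z$. $I(\cdot\,;\cdot)$ and $I(\cdot\,;\cdot|\cdot)$ denote Shannon (conditional) mutual information. An information decomposition consists of functions $SI,UI,CI$ with $I(S;YZ)=SI(S;Y,Z)+CI(S;Y,Z)+UI(S;Y\setminus Z)+UI(S;Z\setminus Y)$, $I(S;Y)=SI(S;Y,Z)+UI(S;Y\setminus Z)$, $I(S;Z)=SI(S;Y,Z)+UI(S;Z\setminus Y)$, and is called continuous if $SI,UI,CI$ are all continuous (since mutual information is continuous, this is equivalent to continuity of $SI$). The decompositions $I_\cap^{\wedge}$, $I_\cap^{\mathrm{GH}}$, $I_\cap^{*}$ are defined by the following shared information functions, where $Q$ is a finite-valued random variable: - $SI_\cap^{\wedge}(S;Y,Z)=\max\{I(Q;S): Q=f(Y)=f'(Z)\text{ almost surely}\}$, over all pairs of deterministic functions $f,f'$. - $SI_\cap^{\mathrm{GH}}(S;Y,Z)=\max\{I(Q;S):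 I(S;Q|Y)=I(S;Q|Z)=0\}$, over all joint distributions of four random variables $S,Y,Z,Q$ that extend the joint distribution of $S,Y,Z$. - $SI_\cap^{*}(S;Y,Z)=\max\{I(Q;S): P(s,q)=\sum_yP(s,y)\lambda_{q|y}=\sum_zP(s,z)\lambda'_{q|z}\text{ for all }s,q\}$, over all pairs of stochastic matrices $\lambda_{q|y},\lambda'_{q|z}$ (with $\sum_q\lambda_{q|y}=1$ and $\sum_q\lambda'_{q|z}=1$); here $P(s,q)$ is the resulting joint distribution of $(S,Q)$. *)

theory Defs
  imports "HOL-Probability.Probability"
begin

text \<open>
  A distribution on a finite set is represented by its vector of point probabilities, extended
  by zero outside the set. On functions vanishing outside a finite set, the product topology of
  the type \<open>'a \<Rightarrow> real\<close> induces the Euclidean topology.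
\<close>

definition prob_simplex :: "'a set \<Rightarrow> ('a \<Rightarrow> real) set" where
  "prob_simplex \<Omega> = {P. (\<forall>w. 0 \<le> P w) \<and> (\<forall>w. w \<notin> \<Omega> \<longrightarrow> P w = 0) \<and> (\<Sum>w\<in>\<Omega>. P w) = 1}"

definition dist_measure :: "'a set \<Rightarrow> ('a \<Rightarrow> real) \<Rightarrow> 'a measure" where
  "dist_measure \<Omega> P = point_measure \<Omega> (\<lambda>w. ennreal (P w))"

text \<open>
  On \<open>dist_measure \<Omega> P\<close> the next two definitions are the library's \<open>\<I>(X ; Y)\<close> and
  \<open>\<I>(X ; Y | Z)\<close>, with logarithms to base \<open>b\<close>.
\<close>

definition mutual_info ::
  "real \<Rightarrow> 'w set \<Rightarrow> ('w \<Rightarrow> real) \<Rightarrow> ('w \<Rightarrow> 'x) \<Rightarrow> ('w \<Rightarrow> 'y) \<Rightarrow> real" where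
  "mutual_info b \<Omega> P X Y =
     prob_space.mutual_information (dist_measure \<Omega> P) b
       (count_space (X ` \<Omega>)) (count_space (Y ` \<Omega>)) X Y"

definition cond_mutual_info ::
  "real \<Rightarrow> 'w set \<Rightarrow> ('w \<Rightarrow> real) \<Rightarrow> ('w \<Rightarrow> 'x) \<Rightarrow> ('w \<Rightarrow> 'y) \<Rightarrow> ('w \<Rightarrow> 'z) \<Rightarrow> real" where
  "cond_mutual_info b \<Omega> P X Y Z =
     prob_space.conditional_mutual_information (dist_measure \<Omega> P) b
       (count_space (X ` \<Omega>)) (count_space (Y ` \<Omega>)) (count_space (Z ` \<Omega>)) X Y Z"

text \<open>
  Below, \<open>A\<close>, \<open>B\<close>, \<open>C\<close> are the state spaces of \<open>S\<close>, \<open>Y\<close>, \<open>Z\<close>, and \<open>P\<close> is the joint distribution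
  on \<open>A \<times> B \<times> C\<close>. The values of the finite-valued variable \<open>Q\<close> are labelled by natural numbers.
\<close>

definition SI_wedge_values ::
  "real \<Rightarrow> 's set \<Rightarrow> 'y set \<Rightarrow> 'z set \<Rightarrow> ('s \<times> 'y \<times> 'z \<Rightarrow> real) \<Rightarrow> real set" where
  "SI_wedge_values b A B C P =
     {mutual_info b (A \<times> B \<times> C) P Q (\<lambda>(s, y, z). s) | (Q :: 's \<times> 'y \<times> 'z \<Rightarrow> nat) f f'.
        AE (s, y, z) in dist_measure (A \<times> B \<times> C) P. Q (s, y, z) = f y \<and> Q (s, y, z) = f' z}"

definition SI_wedge ::
  "real \<Rightarrow> 's set \<Rightarrow> 'y set \<Rightarrow> 'z set \<Rightarrow> ('s \<times> 'y \<times> 'z \<Rightarrow> real) \<Rightarrow> real" where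
  "SI_wedge b A B C P = (GREATEST v. v \<in> SI_wedge_values b A B C P)"

definition SI_GH_values ::
  "real \<Rightarrow> 's set \<Rightarrow> 'y set \<Rightarrow> 'z set \<Rightarrow> ('s \<times> 'y \<times> 'z \<Rightarrow> real) \<Rightarrow> real set" where
  "SI_GH_values b A B C P =
     {mutual_info b (A \<times> B \<times> C \<times> D) R (\<lambda>(s, y, z, q). q) (\<lambda>(s, y, z, q). s) | (D :: nat set) R.
        finite D \<and> R \<in> prob_simplex (A \<times> B \<times> C \<times> D) \<and>
        (\<forall>s\<in>A. \<forall>y\<in>B. \<forall>z\<in>C. (\<Sum>q\<in>D. R (s, y, z, q)) = P (s, y, z)) \<and>
        cond_mutual_info b (A \<times> B \<times> C \<times> D) R
          (\<lambda>(s, y, z, q). s) (\<lambda>(s, y, z, q). q) (\<lambda>(s, y, z, q). y) = 0 \<and>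
        cond_mutual_info b (A \<times> B \<times> C \<times> D) R
          (\<lambda>(s, y, z, q). s) (\<lambda>(s, y, z, q). q) (\<lambda>(s, y, z, q). z) = 0}"

definition SI_GH ::
  "real \<Rightarrow> 's set \<Rightarrow> 'y set \<Rightarrow> 'z set \<Rightarrow> ('s \<times> 'y \<times> 'z \<Rightarrow> real) \<Rightarrow> real" where
  "SI_GH b A B C P = (GREATEST v. v \<in> SI_GH_values b A B C P)"

text \<open>\<open>k q y\<close> is the conditional probability of the output \<open>q\<close> given the input \<open>y\<close>.\<close>

definition stochastic_matrix :: "'y set \<Rightarrow> 'q set \<Rightarrow> ('q \<Rightarrow> 'y \<Rightarrow> real) \<Rightarrow> bool" where
  "stochastic_matrix B D k \<longleftrightarrow>
     (\<forall>y\<in>B. (\<forall>q\<in>D. 0 \<le> k q y) \<and> (\<Sum>q\<in>D. k q y) = 1)"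

definition SI_star_values ::
  "real \<Rightarrow> 's set \<Rightarrow> 'y set \<Rightarrow> 'z set \<Rightarrow> ('s \<times> 'y \<times> 'z \<Rightarrow> real) \<Rightarrow> real set" where
  "SI_star_values b A B C P =
     {mutual_info b (A \<times> D) R snd fst | (D :: nat set) R k k'.
        finite D \<and> R \<in> prob_simplex (A \<times> D) \<and>
        stochastic_matrix B D k \<and> stochastic_matrix C D k' \<and>
        (\<forall>s\<in>A. \<forall>q\<in>D.
           R (s, q) = (\<Sum>y\<in>B. (\<Sum>z\<in>C. P (s, y, z)) * k q y) \<and>
           R (s, q) = (\<Sum>z\<in>C. (\<Sum>y\<in>B. P (s, y, z)) * k' q z))}"

definition SI_star ::
  "real \<Rightarrow> 's set \<Rightarrow> 'y set \<Rightarrow> 'z set \<Rightarrow> ('s \<times> 'y \<times> 'z \<Rightarrow> real) \<Rightarrow> real" where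
  "SI_star b A B C P = (GREATEST v. v \<in> SI_star_values b A B C P)"

end

theory Submission
  imports Defs
begin

text \<open>
  Let \<open>Y\<close> be a fair bit, let \<open>Z\<close> be \<open>Y\<close> with a bit flip of probability \<open>t\<close>, and let \<open>S = (Y, Z)\<close>.
  For \<open>t = 0\<close> all three variables are copies of one bit, and all three measures
  equal \<open>log b 2\<close>. For \<open>0 < t < 1\<close> all pairs \<open>(y, z)\<close> have positive probability, and since
  \<open>S\<close> determines both \<open>Y\<close> and \<open>Z\<close>, each of the three constraints forces the conditional law of
  \<open>Q\<close> given \<open>(y, z)\<close> to depend on \<open>y\<close> alone and on \<open>z\<close> alone. So \<open>Q\<close> is
  independent of \<open>S\<close> and the measures vanish.
\<close>

section \<open>Laws of random variables on a finite probability space\<close>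

text \<open>The probability mass function of \<open>X\<close>. The form of a plain sum with a
  conditional lets sums over values be exchanged with the sum over outcomes, and lets explicit laws
  be evaluated by simplification.\<close>

definition law :: "'w set \<Rightarrow> ('w \<Rightarrow> real) \<Rightarrow> ('w \<Rightarrow> 'x) \<Rightarrow> 'x \<Rightarrow> real" where
  "law \<Omega> P X x = (\<Sum>w\<in>\<Omega>. if X w = x then P w else 0)"

lemma prob_simplexD:
  assumes "P \<in> prob_simplex \<Omega>"
  shows "0 \<le> P w" "w \<notin> \<Omega> \<Longrightarrow> P w = 0" "sum P \<Omega> = 1"
  using assms by (auto simp: prob_simplex_def)

lemma law_nonneg: "P \<in> prob_simplex \<Omega> \<Longrightarrow> 0 \<le> law \<Omega> P X x"
  by (auto simp: law_def prob_simplexD intro!: sum_nonneg)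

text \<open>Only outcomes of nonzero mass count. This replaces a joint law by a marginal one when
  one variable determines another on the support.\<close>

lemma law_cong:
  assumes "\<And>w. w \<in> \<Omega> \<Longrightarrow> P w \<noteq> 0 \<Longrightarrow> X w = x \<longleftrightarrow> X' w = x'"
  shows "law \<Omega> P X x = law \<Omega> P X' x'"
  unfolding law_def using assms by (intro sum.cong) auto

lemma law_mono:
  assumes "P \<in> prob_simplex \<Omega>" "\<And>w. w \<in> \<Omega> \<Longrightarrow> X w = x \<Longrightarrow> X' w = x'"
  shows "law \<Omega> P X x \<le> law \<Omega> P X' x'"
  unfolding law_def using assms by (intro sum_mono) (auto simp: prob_simplexD)

lemma law_ge_outcome:
  assumes "finite \<Omega>" "P \<in> prob_simplex \<Omega>" "w \<in> \<Omega>"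
  shows "P w \<le> law \<Omega> P X (X w)"
proof -
  have "(if X w = X w then P w else 0) \<le> law \<Omega> P X (X w)"
    unfolding law_def using assms by (intro member_le_sum) (auto simp: prob_simplexD)
  then show ?thesis by simp
qed

text \<open>The transformation formula for expectations. Values in \<open>T\<close> that
  \<open>X\<close> does not take have law zero.\<close>

lemma sum_law_fun:
  assumes "finite \<Omega>" "finite T" "X ` \<Omega> \<subseteq> T"
  shows "(\<Sum>x\<in>T. law \<Omega> P X x * h x) = (\<Sum>w\<in>\<Omega>. P w * h (X w))"
proof -
  have "(\<Sum>x\<in>T. law \<Omega> P X x * h x) = (\<Sum>x\<in>T. \<Sum>w\<in>\<Omega>. if X w = x then P w * h x else 0)"
    unfolding law_def sum_distrib_right by (intro sum.cong) auto
  also have "\<dots> = (\<Sum>w\<in>\<Omega>. \<Sum>x\<in>T. if X w = x then P w * h x else 0)"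
    by (rule sum.swap)
  also have "\<dots> = (\<Sum>w\<in>\<Omega>. P w * h (X w))"
    using assms by (intro sum.cong) auto
  finally show ?thesis .
qed

lemma sum_law:
  assumes "finite \<Omega>" "P \<in> prob_simplex \<Omega>" "finite T" "X ` \<Omega> \<subseteq> T"
  shows "(\<Sum>x\<in>T. law \<Omega> P X x) = 1"
  using sum_law_fun[OF assms(1,3,4), of P "\<lambda>_. 1"] prob_simplexD(3)[OF assms(2)] by simp

lemma sum_law_Pair:
  assumes "finite T" "X ` \<Omega> \<subseteq> T"
  shows "(\<Sum>x\<in>T. law \<Omega> P (\<lambda>w. (X w, Y w)) (x, y)) = law \<Omega> P Y y"
proof -
  have "(\<Sum>x\<in>T. law \<Omega> P (\<lambda>w. (X w, Y w)) (x, y))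
      = (\<Sum>w\<in>\<Omega>. \<Sum>x\<in>T. if (X w, Y w) = (x, y) then P w else 0)"
    unfolding law_def by (rule sum.swap)
  also have "\<dots> = (\<Sum>w\<in>\<Omega>. \<Sum>x\<in>T. if X w = x then if Y w = y then P w else 0 else 0)"
    by (intro sum.cong) auto
  also have "\<dots> = law \<Omega> P Y y"
    unfolding law_def using assms by (intro sum.cong) auto
  finally show ?thesis .
qed

lemma sum_law_Pair':
  assumes "finite T" "Y ` \<Omega> \<subseteq> T"
  shows "(\<Sum>y\<in>T. law \<Omega> P (\<lambda>w. (X w, Y w)) (x, y)) = law \<Omega> P X x"
proof -
  have "(\<Sum>y\<in>T. law \<Omega> P (\<lambda>w. (X w, Y w)) (x, y)) = (\<Sum>y\<in>T. law \<Omega> P (\<lambda>w. (Y w, X w)) (y, x))"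
    by (intro sum.cong law_cong) auto
  also have "\<dots> = law \<Omega> P X x" using assms by (rule sum_law_Pair)
  finally show ?thesis .
qed

section \<open>Mutual information as a finite sum\<close>

lemma information_space_dist_measure:
  assumes "finite \<Omega>" "P \<in> prob_simplex \<Omega>" "b > 1"
  shows "information_space (dist_measure \<Omega> P) b"
proof -
  have "(\<Sum>w\<in>\<Omega>. ennreal (P w)) = 1"
    using assms by (subst sum_ennreal) (auto simp: prob_simplexD)
  then have "prob_space (dist_measure \<Omega> P)"
    unfolding dist_measure_def using assms by (intro prob_space_point_measure) auto
  then show ?thesis
    using assms by (simp add: information_space_def information_space_axioms_def)
qed

text \<open>The bridge to the library, whose information formulas for simple random variables take
  mass functions in this form.\<close>

lemma simple_distributed_law:
  assumes "finite \<Omega>" "P \<in> prob_simplex \<Omega>"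
  shows "simple_distributed (dist_measure \<Omega> P) X (law \<Omega> P X)"
proof -
  interpret information_space "dist_measure \<Omega> P" 2
    using assms by (intro information_space_dist_measure) auto
  have "law \<Omega> P X x = measure (dist_measure \<Omega> P) (X -` {x} \<inter> \<Omega>)" for x
  proof -
    have "measure (dist_measure \<Omega> P) (X -` {x} \<inter> \<Omega>) = (\<Sum>w\<in>X -` {x} \<inter> \<Omega>. P w)"
      using assms unfolding dist_measure_def measure_def
      by (subst emeasure_point_measure_finite) (auto simp: prob_simplexD sum_nonneg)
    also have "\<dots> = law \<Omega> P X x"
      unfolding law_def using assms by (simp add: sum.If_cases vimage_def Int_commute)
    finally show ?thesis ..
  qed
  moreover have "simple_function (dist_measure \<Omega> P) X"
    using assms by (auto simp: simple_function_def dist_measure_def space_point_measure sets_point_measure)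
  ultimately show ?thesis
    using assms law_nonneg by (intro simple_distributedI) (auto simp: dist_measure_def space_point_measure)
qed

text \<open>Summing over outcomes instead of pairs of values makes the weights \<open>P w\<close>,
  so that a pointwise identity or bound on the support carries over to the whole sum.\<close>

lemma mutual_info_eq_sum:
  assumes "finite \<Omega>" "P \<in> prob_simplex \<Omega>" "b > 1"
  shows "mutual_info b \<Omega> P X Y =
    (\<Sum>w\<in>\<Omega>. P w * log b (law \<Omega> P (\<lambda>w. (X w, Y w)) (X w, Y w) /
        (law \<Omega> P X (X w) * law \<Omega> P Y (Y w))))"
proof -
  interpret information_space "dist_measure \<Omega> P" b
    using assms by (rule information_space_dist_measure)
  have sp: "space (dist_measure \<Omega> P) = \<Omega>" by (simp add: dist_measure_def space_point_measure)
  note sd = simple_distributed_law[OF assms(1,2)]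
  show ?thesis
    unfolding mutual_info_def
      mutual_information_simple_distributed[OF sd[of X] sd[of Y] sd, unfolded sp]
    using sum_law_fun[OF assms(1), of _ "\<lambda>w. (X w, Y w)" P
      "\<lambda>t. log b (law \<Omega> P (\<lambda>w. (X w, Y w)) t / (law \<Omega> P X (fst t) * law \<Omega> P Y (snd t)))"] assms(1)
    by (simp only: case_prod_unfold fst_conv snd_conv prod.collapse finite_imageI order_refl)
qed

text \<open>The sum stays over triples of values, because the Gibbs argument below compares two mass
  functions on such triples.\<close>

lemma cond_mutual_info_eq_sum:
  assumes "finite \<Omega>" "P \<in> prob_simplex \<Omega>" "b > 1"
  shows "cond_mutual_info b \<Omega> P X Y Z =
    (\<Sum>(x, y, z)\<in>(\<lambda>w. (X w, Y w, Z w)) ` \<Omega>. law \<Omega> P (\<lambda>w. (X w, Y w, Z w)) (x, y, z) *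
      log b (law \<Omega> P (\<lambda>w. (X w, Y w, Z w)) (x, y, z) /
        (law \<Omega> P (\<lambda>w. (X w, Z w)) (x, z) * (law \<Omega> P (\<lambda>w. (Y w, Z w)) (y, z) / law \<Omega> P Z z))))"
proof -
  interpret information_space "dist_measure \<Omega> P" b
    using assms by (rule information_space_dist_measure)
  have sp: "space (dist_measure \<Omega> P) = \<Omega>" by (simp add: dist_measure_def space_point_measure)
  note sd = simple_distributed_law[OF assms(1,2)]
  show ?thesis
    unfolding cond_mutual_info_def
    using conditional_mutual_information_eq[OF sd[of Z] sd sd sd, of X Y] by (simp add: sp)
qed

text \<open>All logarithms on the support equal \<open>log b c\<close>, and the weights sum to 1.
  The case \<open>c = 1\<close> is independence; \<open>c = 2\<close> is a shared fair bit.\<close>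

lemma mutual_info_eq_log:
  assumes "finite \<Omega>" "P \<in> prob_simplex \<Omega>" "b > 1"
    and "\<And>w. w \<in> \<Omega> \<Longrightarrow> P w > 0 \<Longrightarrow>
      law \<Omega> P (\<lambda>w. (X w, Y w)) (X w, Y w) = c * law \<Omega> P X (X w) * law \<Omega> P Y (Y w)"
  shows "mutual_info b \<Omega> P X Y = log b c"
proof -
  have "mutual_info b \<Omega> P X Y = (\<Sum>w\<in>\<Omega>. P w * log b c)"
    unfolding mutual_info_eq_sum[OF assms(1-3)]
  proof (intro sum.cong refl)
    fix w assume w: "w \<in> \<Omega>"
    show "P w * log b (law \<Omega> P (\<lambda>w. (X w, Y w)) (X w, Y w) /
        (law \<Omega> P X (X w) * law \<Omega> P Y (Y w))) = P w * log b c"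
    proof (cases "P w > 0")
      case True
      then have "law \<Omega> P X (X w) > 0" "law \<Omega> P Y (Y w) > 0"
        using law_ge_outcome[OF assms(1,2) w] by (metis less_le_trans)+
      then show ?thesis using assms(4)[OF w True] by simp
    next
      case False
      then show ?thesis using prob_simplexD(1)[OF assms(2), of w] by simp
    qed
  qed
  also have "\<dots> = log b c"
    using assms by (simp add: prob_simplexD flip: sum_distrib_right)
  finally show ?thesis .
qed

text \<open>The joint law is at most the law of \<open>X\<close>, so the ratio under the logarithm
  is at most the reciprocal of the law of \<open>Y\<close>, hence at most \<open>c\<close>.\<close>

lemma mutual_info_le_log:
  assumes "finite \<Omega>" "P \<in> prob_simplex \<Omega>" "b > 1" "c > 0"
    and "\<And>w. w \<in> \<Omega> \<Longrightarrow> P w > 0 \<Longrightarrow> 1 \<le> c * law \<Omega> P Y (Y w)"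
  shows "mutual_info b \<Omega> P X Y \<le> log b c"
proof -
  have "mutual_info b \<Omega> P X Y \<le> (\<Sum>w\<in>\<Omega>. P w * log b c)"
    unfolding mutual_info_eq_sum[OF assms(1-3)]
  proof (intro sum_mono)
    fix w assume w: "w \<in> \<Omega>"
    show "P w * log b (law \<Omega> P (\<lambda>w. (X w, Y w)) (X w, Y w) /
        (law \<Omega> P X (X w) * law \<Omega> P Y (Y w))) \<le> P w * log b c"
    proof (cases "P w > 0")
      case True
      let ?xy = "law \<Omega> P (\<lambda>w. (X w, Y w)) (X w, Y w)"
      let ?x = "law \<Omega> P X (X w)" and ?y = "law \<Omega> P Y (Y w)"
      have pos: "?x > 0" "?y > 0" "?xy > 0"
        using law_ge_outcome[OF assms(1,2) w] True by (metis less_le_trans)+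
      have "?xy \<le> ?x" using assms(2) by (rule law_mono) auto
      also have "\<dots> \<le> ?x * (c * ?y)"
        using assms(5)[OF w True] pos by simp
      finally have "?xy / (?x * ?y) \<le> c"
        using pos by (simp add: divide_simps mult_ac)
      then have "log b (?xy / (?x * ?y)) \<le> log b c"
        using pos assms(3,4) by (subst log_le_cancel_iff) auto
      then show ?thesis using True by simp
    next
      case False
      then show ?thesis using prob_simplexD(1)[OF assms(2), of w] by simp
    qed
  qed
  also have "\<dots> = log b c"
    using assms by (simp add: prob_simplexD flip: sum_distrib_right)
  finally show ?thesis .
qed

lemma mutual_info_eq_log_2:
  assumes "finite \<Omega>" "P \<in> prob_simplex \<Omega>" "b > 1"
    and "\<And>w. w \<in> \<Omega> \<Longrightarrow> P w > 0 \<Longrightarrow> law \<Omega> P X (X w) = 1 / 2 \<and> law \<Omega> P Y (Y w) = 1 / 2 \<and>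
      law \<Omega> P (\<lambda>w. (X w, Y w)) (X w, Y w) = 1 / 2"
  shows "mutual_info b \<Omega> P X Y = log b 2"
  using assms(1-3)
proof (rule mutual_info_eq_log)
  fix w assume "w \<in> \<Omega>" "P w > 0"
  then have half: "law \<Omega> P X (X w) = 1 / 2" "law \<Omega> P Y (Y w) = 1 / 2"
    "law \<Omega> P (\<lambda>w. (X w, Y w)) (X w, Y w) = 1 / 2"
    using assms(4) by blast+
  show "law \<Omega> P (\<lambda>w. (X w, Y w)) (X w, Y w) = 2 * law \<Omega> P X (X w) * law \<Omega> P Y (Y w)"
    unfolding half by simp
qed

section \<open>Gibbs' inequality and conditional independence\<close>

text \<open>With \<open>u = g / f\<close> the expression is \<open>f * (u - 1 - ln u)\<close>, and
  \<open>ln u \<le> u - 1\<close> with equality only at \<open>u = 1\<close>. For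
  \<open>f = 0\<close> it reduces to \<open>g\<close>.\<close>

lemma mult_ln_div_ge:
  fixes f g :: real
  assumes "0 \<le> f" "0 \<le> g" "g = 0 \<Longrightarrow> f = 0"
  shows "0 \<le> f * ln (f / g) - f + g" "f * ln (f / g) - f + g = 0 \<Longrightarrow> f = g"
proof -
  have "0 \<le> f * ln (f / g) - f + g \<and> (f * ln (f / g) - f + g = 0 \<longrightarrow> f = g)"
  proof (cases "f = 0")
    case False
    then have pos: "f > 0" "g > 0" using assms by force+
    have eq: "f * ln (f / g) - f + g = f * (g / f - 1 - ln (g / f))"
      using pos by (simp add: ln_div field_simps)
    have "ln (g / f) \<le> g / f - 1" using pos by (intro ln_le_minus_one) auto
    moreover have "g / f = 1" if "ln (g / f) = g / f - 1"
      using pos that by (intro ln_eq_minus_one) auto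
    ultimately show ?thesis using pos unfolding eq by auto
  qed (use assms in auto)
  then show "0 \<le> f * ln (f / g) - f + g" "f * ln (f / g) - f + g = 0 \<Longrightarrow> f = g" by auto
qed

text \<open>Adding \<open>g x - f x\<close> to each summand does not raise the total above zero, but
  makes every summand nonnegative. So all summands vanish, which forces equality pointwise.\<close>

lemma Gibbs_equality:
  fixes f g :: "'a \<Rightarrow> real"
  assumes "finite T" "b > 1"
    and "\<And>x. x \<in> T \<Longrightarrow> 0 \<le> f x" "\<And>x. x \<in> T \<Longrightarrow> 0 \<le> g x" "\<And>x. x \<in> T \<Longrightarrow> g x = 0 \<Longrightarrow> f x = 0"
    and "sum g T \<le> sum f T" "(\<Sum>x\<in>T. f x * log b (f x / g x)) \<le> 0" "x \<in> T"
  shows "f x = g x"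
proof -
  have "(\<Sum>x\<in>T. f x * log b (f x / g x)) = (\<Sum>x\<in>T. f x * ln (f x / g x)) / ln b"
    by (simp add: log_def sum_divide_distrib)
  then have "(\<Sum>x\<in>T. f x * ln (f x / g x)) \<le> 0"
    using assms(2,7) by (simp add: divide_le_0_iff ln_gt_zero)
  then have "(\<Sum>x\<in>T. f x * ln (f x / g x) - f x + g x) \<le> 0"
    using assms(6) by (simp add: sum.distrib sum_subtractf)
  moreover have nonneg: "0 \<le> f x * ln (f x / g x) - f x + g x" if "x \<in> T" for x
    by (rule mult_ln_div_ge(1)[OF assms(3-5)]) (simp_all add: that)
  ultimately have "(\<Sum>x\<in>T. f x * ln (f x / g x) - f x + g x) = 0"
    by (intro antisym sum_nonneg) auto
  then have "f x * ln (f x / g x) - f x + g x = 0"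
    using sum_nonneg_eq_0_iff[OF assms(1) nonneg] assms(8) by auto
  then show ?thesis
    using mult_ln_div_ge(2)[OF assms(3-5)] assms(8) by simp
qed

text \<open>The equality case of Gibbs' inequality, applied to the joint law and to the law that
  conditional independence would give. The criterion is cross-multiplied so that it also makes sense
  where \<open>Z\<close> has law zero.\<close>

lemma cond_mutual_info_eq_0_iff:
  assumes fin: "finite \<Omega>" and P: "P \<in> prob_simplex \<Omega>" and "b > 1"
  shows "cond_mutual_info b \<Omega> P X Y Z = 0 \<longleftrightarrow>
    (\<forall>x y z. law \<Omega> P (\<lambda>w. (X w, Y w, Z w)) (x, y, z) * law \<Omega> P Z z =
       law \<Omega> P (\<lambda>w. (X w, Z w)) (x, z) * law \<Omega> P (\<lambda>w. (Y w, Z w)) (y, z))"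
    (is "?I = 0 \<longleftrightarrow> ?R")
proof -
  let ?f = "law \<Omega> P (\<lambda>w. (X w, Y w, Z w))" and ?h = "law \<Omega> P Z"
  let ?k = "law \<Omega> P (\<lambda>w. (X w, Z w))" and ?l = "law \<Omega> P (\<lambda>w. (Y w, Z w))"
  have null: "law \<Omega> P W x = 0" if "x \<notin> W ` \<Omega>" for x and W :: "'a \<Rightarrow> 'w"
    unfolding law_def using that by (intro sum.neutral) auto
  note nn = law_nonneg[OF P]
  define g where "g = (\<lambda>(x, y, z). ?k (x, z) * (?l (y, z) / ?h z))"
  have le: "?f (x, y, z) \<le> ?k (x, z)" "?f (x, y, z) \<le> ?l (y, z)" "?f (x, y, z) \<le> ?h z"
    "?k (x, z) \<le> ?h z" for x y z
    by (auto intro!: law_mono[OF P])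
  have pos: "?f (x, y, z) > 0" "?k (x, z) > 0" "?l (y, z) > 0" "?h z > 0"
    if "?f (x, y, z) \<noteq> 0" for x y z
  proof -
    show f: "?f (x, y, z) > 0" using that nn[of _ "(x, y, z)"] by (simp add: order_less_le)
    show "?k (x, z) > 0" "?l (y, z) > 0" "?h z > 0" using f le less_le_trans by blast+
  qed
  show ?thesis
  proof
    assume I: "?I = 0"
    \<comment> \<open>The full product of the ranges, not only the triples that occur: at a triple
      of joint law zero, \<open>g\<close> could still be positive, and its vanishing there is part
      of the claim.\<close>
    define T where "T = X ` \<Omega> \<times> Y ` \<Omega> \<times> Z ` \<Omega>"
    have "?I = (\<Sum>t\<in>(\<lambda>w. (X w, Y w, Z w)) ` \<Omega>. ?f t * log b (?f t / g t))"
      unfolding cond_mutual_info_eq_sum[OF assms] g_def by (intro sum.cong) auto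
    also have "\<dots> = (\<Sum>t\<in>T. ?f t * log b (?f t / g t))"
      using fin by (intro sum.mono_neutral_left) (auto simp: T_def null)
    finally have S: "(\<Sum>t\<in>T. ?f t * log b (?f t / g t)) \<le> 0" using I by simp
    have "sum ?f T = 1"
      using fin by (intro sum_law[OF fin P]) (auto simp: T_def)
    moreover have "sum g T = (\<Sum>x\<in>X ` \<Omega>. \<Sum>z\<in>Z ` \<Omega>. \<Sum>y\<in>Y ` \<Omega>. g (x, y, z))"
      unfolding T_def sum.cartesian_product' by (intro sum.cong sum.swap refl)
    moreover have "\<dots> = (\<Sum>x\<in>X ` \<Omega>. \<Sum>z\<in>Z ` \<Omega>. ?k (x, z))"
    proof (intro sum.cong refl)
      fix x z
      \<comment> \<open>If \<open>?h z = 0\<close> the quotient is 0 by convention; then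
        \<open>?k (x, z) \<le> ?h z\<close> makes \<open>?k (x, z)\<close> zero as well.\<close>
      have "(\<Sum>y\<in>Y ` \<Omega>. g (x, y, z)) = ?k (x, z) * (?h z / ?h z)"
        using fin unfolding g_def
        by (simp add: sum_law_Pair flip: sum_distrib_left sum_divide_distrib)
      also have "\<dots> = ?k (x, z)"
        using le(4)[of x z] nn[of "\<lambda>w. (X w, Z w)" "(x, z)"] by (cases "?h z = 0") auto
      finally show "(\<Sum>y\<in>Y ` \<Omega>. g (x, y, z)) = ?k (x, z)" .
    qed
    moreover have "\<dots> = 1"
      using fin by (simp add: sum_law_Pair' sum_law[OF fin P])
    ultimately have sg: "sum g T \<le> sum ?f T" by simp
    have fg: "?f t = g t" if "t \<in> T" for t
    proof (rule Gibbs_equality[where f = ?f and g = g and T = T, OF _ \<open>b > 1\<close> _ _ _ sg S that])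
      show "finite T" using fin by (simp add: T_def)
      show "0 \<le> ?f t" for t by (rule nn)
      show "0 \<le> g t" for t by (auto simp: g_def nn intro!: mult_nonneg_nonneg divide_nonneg_nonneg split: prod.split)
      show "?f t = 0" if "g t = 0" for t
      proof (rule ccontr)
        assume f: "?f t \<noteq> 0"
        obtain x y z where t: "t = (x, y, z)" by (cases t)
        then show False using pos[of x y z] f that by (simp add: g_def)
      qed
    qed
    show ?R
    proof (intro allI)
      fix x y z
      show "?f (x, y, z) * ?h z = ?k (x, z) * ?l (y, z)"
      proof (cases "(x, y, z) \<in> T")
        case True
        have "?k (x, z) = 0" if "?h z = 0"
          using le(4)[of x z] nn[of "\<lambda>w. (X w, Z w)" "(x, z)"] that by simp
        then show ?thesis using fg[OF True] by (cases "?h z = 0") (auto simp: g_def)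
      next
        \<comment> \<open>Some coordinate lies outside its range, so the joint law and at least one
          factor on the right vanish.\<close>
        case False
        then have "?f (x, y, z) = 0" by (intro null) (auto simp: T_def)
        moreover have "?k (x, z) = 0 \<or> ?l (y, z) = 0"
        proof (rule ccontr)
          assume "\<not> ?thesis"
          then have "(x, z) \<in> (\<lambda>w. (X w, Z w)) ` \<Omega>" "(y, z) \<in> (\<lambda>w. (Y w, Z w)) ` \<Omega>"
            using null[of "(x, z)" "\<lambda>w. (X w, Z w)"] null[of "(y, z)" "\<lambda>w. (Y w, Z w)"] by argo+
          then show False using False by (auto simp: T_def)
        qed
        ultimately show ?thesis by auto
      qed
    qed
  next
    assume R: ?R
    show "?I = 0"
      unfolding cond_mutual_info_eq_sum[OF assms]
    proof (intro sum.neutral ballI, safe)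
      fix x y z
      have "?f (x, y, z) / (?k (x, z) * (?l (y, z) / ?h z)) = 1" if "?f (x, y, z) \<noteq> 0"
        using pos[OF that] R by (simp add: field_simps)
      then show "?f (x, y, z) * log b (?f (x, y, z) / (?k (x, z) * (?l (y, z) / ?h z))) = 0"
        by (cases "?f (x, y, z) = 0") (simp_all only: simp_thms not_False_eq_True mult_zero_left log_one mult_zero_right)
    qed
  qed
qed

text \<open>No outcome of nonzero mass other than \<open>w\<close> lies in the event. Since
  \<open>S\<close> will determine \<open>Y\<close> and \<open>Z\<close>, this reduces joint laws to
  point probabilities.\<close>

lemma law_eq_outcome:
  assumes "finite \<Omega>" "w \<in> \<Omega>" "\<And>w'. w' \<in> \<Omega> \<Longrightarrow> P w' \<noteq> 0 \<Longrightarrow> X w' = x \<longleftrightarrow> w' = w"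
  shows "law \<Omega> P X x = P w"
proof -
  have "law \<Omega> P X x = law \<Omega> P (\<lambda>w. w) w" using assms(3) by (intro law_cong) auto
  also have "\<dots> = P w" unfolding law_def using assms(1,2) by simp
  finally show ?thesis .
qed

text \<open>Summing the factorization over \<open>y\<close> shows that \<open>\<kappa>\<close> is
  the law of \<open>X\<close>, so it need not be identified beforehand.\<close>

lemma mutual_info_eq_0I:
  assumes fin: "finite \<Omega>" and P: "P \<in> prob_simplex \<Omega>" and "b > 1"
    and fac: "\<And>x y. x \<in> X ` \<Omega> \<Longrightarrow> y \<in> Y ` \<Omega> \<Longrightarrow>
      law \<Omega> P (\<lambda>w. (X w, Y w)) (x, y) = \<kappa> x * law \<Omega> P Y y"
  shows "mutual_info b \<Omega> P X Y = 0"
proof -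
  have "law \<Omega> P X x = \<kappa> x" if "x \<in> X ` \<Omega>" for x
  proof -
    have "law \<Omega> P X x = (\<Sum>y\<in>Y ` \<Omega>. law \<Omega> P (\<lambda>w. (X w, Y w)) (x, y))"
      using fin by (simp add: sum_law_Pair')
    also have "\<dots> = \<kappa> x"
      using fin that by (simp add: fac sum_law[OF fin P] flip: sum_distrib_left)
    finally show ?thesis .
  qed
  then have "mutual_info b \<Omega> P X Y = log b 1"
    by (intro mutual_info_eq_log[OF assms(1-3)]) (simp add: fac)
  then show ?thesis by simp
qed

text \<open>Given \<open>Z\<close>, the variable \<open>Y\<close> is almost surely constant. In the
  criterion, the laws match in pairs if \<open>y = h z\<close>, and the laws involving
  \<open>y\<close> vanish otherwise.\<close>

lemma cond_mutual_info_eq_0I: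
  assumes "finite \<Omega>" "P \<in> prob_simplex \<Omega>" "b > 1"
    and "\<And>w. w \<in> \<Omega> \<Longrightarrow> P w \<noteq> 0 \<Longrightarrow> Y w = h (Z w)"
  shows "cond_mutual_info b \<Omega> P X Y Z = 0"
  unfolding cond_mutual_info_eq_0_iff[OF assms(1-3)]
proof (intro allI)
  fix x y z
  show "law \<Omega> P (\<lambda>w. (X w, Y w, Z w)) (x, y, z) * law \<Omega> P Z z =
       law \<Omega> P (\<lambda>w. (X w, Z w)) (x, z) * law \<Omega> P (\<lambda>w. (Y w, Z w)) (y, z)"
  proof (cases "y = h z")
    case True
    then have "law \<Omega> P (\<lambda>w. (X w, Y w, Z w)) (x, y, z) = law \<Omega> P (\<lambda>w. (X w, Z w)) (x, z)"
      "law \<Omega> P (\<lambda>w. (Y w, Z w)) (y, z) = law \<Omega> P Z z"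
      using assms(4) by (intro law_cong; fastforce)+
    then show ?thesis by simp
  next
    case False
    then have "law \<Omega> P (\<lambda>w. (X w, Y w, Z w)) (x, y, z) = 0" "law \<Omega> P (\<lambda>w. (Y w, Z w)) (y, z) = 0"
      unfolding law_def using assms(4) by (intro sum.neutral; fastforce)+
    then show ?thesis by simp
  qed
qed

text \<open>The innermost sum, over \<open>q\<close>, collapses to \<open>P\<close>. Thus an
  extension by \<open>Q\<close> inherits the laws of functions of \<open>(S, Y, Z)\<close>.\<close>

lemma law_marginal:
  assumes "\<And>s y z. s \<in> A \<Longrightarrow> y \<in> B \<Longrightarrow> z \<in> C \<Longrightarrow> (\<Sum>q\<in>D. R (s, y, z, q)) = P (s, y, z)"
  shows "law (A \<times> B \<times> C \<times> D) R (\<lambda>(s, y, z, q). X s y z) x = law (A \<times> B \<times> C) P (\<lambda>(s, y, z). X s y z) x"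
  unfolding law_def sum.cartesian_product' using assms
  by (intro sum.cong refl) (auto intro!: sum.neutral)

section \<open>The noisy copy of a fair bit\<close>

text \<open>The value \<open>(y, z)\<close> of \<open>S\<close> is coded as \<open>2 * y + z\<close>.\<close>

definition noisy_copy :: "real \<Rightarrow> nat \<times> nat \<times> nat \<Rightarrow> real" where
  "noisy_copy t = (\<lambda>(s, y, z).
     if y < 2 \<and> z < 2 \<and> s = 2 * y + z then if y = z then (1 - t) / 2 else t / 2 else 0)"

abbreviation outcomes :: "(nat \<times> nat \<times> nat) set" where
  "outcomes \<equiv> {..<4} \<times> {..<2} \<times> {..<2}"

lemma sum_lessThan_2: "(\<Sum>i<2. f i) = f 0 + f (1 :: nat)"
  by (simp add: numeral_2_eq_2)

lemma sum_lessThan_4: "(\<Sum>i<4. f i) = f 0 + f 1 + f 2 + f (3 :: nat)"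
  by (simp add: numeral_eq_Suc)

lemma less_4_cases: "(y::nat) < 4 \<longleftrightarrow> y = 0 \<or> y = 1 \<or> y = 2 \<or> y = 3"
  by auto

lemma noisy_copy_in_simplex:
  assumes "0 \<le> t" "t \<le> 1"
  shows "noisy_copy t \<in> prob_simplex outcomes"
  using assms by (auto simp: prob_simplex_def noisy_copy_def sum.cartesian_product'
    sum_lessThan_2 sum_lessThan_4)

text \<open>\<open>div\<close> and \<open>mod\<close> decode \<open>s\<close>. For
  \<open>s \<ge> 4\<close> the decoded \<open>y\<close> is at least 2, so both sides are
  zero.\<close>

lemma law_noisy_copy_S:
  "law outcomes (noisy_copy t) (\<lambda>(s, y, z). s) s = noisy_copy t (s, s div 2, s mod 2)"
proof (cases "s < 4")
  case True
  then show ?thesis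
    by (intro law_eq_outcome) (auto simp: noisy_copy_def split: if_splits)
next
  case False
  then show ?thesis
    by (auto simp: law_def noisy_copy_def intro!: sum.neutral)
qed

lemma law_noisy_copy_Y: "y < 2 \<Longrightarrow> law outcomes (noisy_copy t) (\<lambda>(s, y, z). y) y = 1 / 2"
  by (auto simp: law_def noisy_copy_def sum.cartesian_product'
    sum_lessThan_2 sum_lessThan_4 less_2_cases_iff field_simps)

lemma law_noisy_copy_Z: "z < 2 \<Longrightarrow> law outcomes (noisy_copy t) (\<lambda>(s, y, z). z) z = 1 / 2"
  by (auto simp: law_def noisy_copy_def sum.cartesian_product'
    sum_lessThan_2 sum_lessThan_4 less_2_cases_iff field_simps)

lemma noisy_copy_0_cases: "noisy_copy 0 w = 0 \<or> noisy_copy 0 w = 1 / 2"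
  by (cases w) (auto simp: noisy_copy_def)

text \<open>At \<open>t = 0\<close> every value of \<open>S\<close> with positive probability has
  probability 1/2, which bounds the information of any \<open>Q\<close> about \<open>S\<close>. The
  space \<open>\<Omega>\<close> is left general to serve all three measures.\<close>

lemma mutual_info_le_log_2:
  assumes "finite \<Omega>" "R \<in> prob_simplex \<Omega>" "b > 1"
    and S: "\<And>s. law \<Omega> R S s = law outcomes (noisy_copy 0) (\<lambda>(s, y, z). s) s"
  shows "mutual_info b \<Omega> R Q S \<le> log b 2"
proof (rule mutual_info_le_log[OF assms(1-3)])
  fix w assume "w \<in> \<Omega>" "R w > 0"
  then have "law \<Omega> R S (S w) > 0"
    using law_ge_outcome[OF assms(1,2)] less_le_trans by blast
  then show "1 \<le> 2 * law \<Omega> R S (S w)"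
    using noisy_copy_0_cases[of "(S w, S w div 2, S w mod 2)"] by (auto simp: S law_noisy_copy_S)
qed simp

text \<open>The path \<open>noisy_copy\<close> is continuous in each coordinate, hence in the
  product topology. Along it \<open>F\<close> is zero for small positive \<open>t\<close> but not at
  the limit point.\<close>

lemma not_continuous_noisy_copy:
  fixes F :: "_ \<Rightarrow> real"
  assumes "F (noisy_copy 0) \<noteq> 0" "\<And>t. 0 < t \<Longrightarrow> t < 1 \<Longrightarrow> F (noisy_copy t) = 0"
  shows "\<not> continuous_on (prob_simplex outcomes) F"
proof
  assume cont: "continuous_on (prob_simplex outcomes) F"
  \<comment> \<open>The shift by 2 keeps \<open>t 0\<close> strictly below 1.\<close>
  define t where "t n = inverse (real (n + 2))" for n
  have t: "0 < t n" "t n < 1" for n by (auto simp: t_def inverse_less_1_iff)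
  have "t \<longlonglongrightarrow> 0"
    unfolding t_def by (rule LIMSEQ_ignore_initial_segment[OF lim_inverse_n])
  moreover have "continuous_on UNIV (\<lambda>t. noisy_copy t w)" for w
  proof (cases w)
    case (fields s y z)
    show ?thesis
      unfolding fields
      by (cases "y < 2 \<and> z < 2 \<and> s = 2 * y + z"; cases "y = z")
        (auto simp: noisy_copy_def intro!: continuous_intros)
  qed
  then have "continuous_on UNIV noisy_copy"
    by (rule continuous_on_coordinatewise_then_product)
  ultimately have "(\<lambda>n. noisy_copy (t n)) \<longlonglongrightarrow> noisy_copy 0"
    by (intro continuous_on_tendsto_compose[of UNIV noisy_copy]) auto
  moreover have "noisy_copy (t n) \<in> prob_simplex outcomes" for n
    using t[of n] by (intro noisy_copy_in_simplex) auto
  ultimately have "(\<lambda>n. F (noisy_copy (t n))) \<longlonglongrightarrow> F (noisy_copy 0)"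
    using cont by (intro continuous_on_tendsto_compose[OF cont] noisy_copy_in_simplex) auto
  then have "(\<lambda>n. 0) \<longlonglongrightarrow> F (noisy_copy 0)" using assms(2) t by simp
  then show False using assms(1) by (simp add: tendsto_const_iff)
qed

section \<open>Common functions of \<open>Y\<close> and \<open>Z\<close>\<close>

text \<open>All four pairs \<open>(y, z)\<close> have positive mass, so the almost sure identities
  hold at each of them and \<open>f y = f' z\<close> throughout. Hence \<open>Q\<close> is almost
  surely constant.\<close>

lemma SI_wedge_noisy_copy:
  assumes "b > 1" "0 < t" "t < 1"
  shows "SI_wedge b {..<4} {..<2} {..<2} (noisy_copy t) = 0"
proof -
  note P = noisy_copy_in_simplex[of t]
  let ?S = "\<lambda>(s, y, z). s :: nat"
  have "v = 0" if v: "v \<in> SI_wedge_values b {..<4} {..<2} {..<2} (noisy_copy t)" for v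
  proof -
    obtain Q :: "nat \<times> nat \<times> nat \<Rightarrow> nat" and f f' where
      v: "v = mutual_info b outcomes (noisy_copy t) Q ?S"
      and AE: "AE (s, y, z) in dist_measure outcomes (noisy_copy t).
        Q (s, y, z) = f y \<and> Q (s, y, z) = f' z"
      using v unfolding SI_wedge_values_def by blast
    have Q: "Q (2 * y + z, y, z) = f y \<and> Q (2 * y + z, y, z) = f' z" if "y < 2" "z < 2" for y z
    proof -
      have "(2 * y + z, y, z) \<in> outcomes" "0 < noisy_copy t (2 * y + z, y, z)"
        using assms that by (auto simp: noisy_copy_def)
      then show ?thesis using AE unfolding dist_measure_def AE_point_measure by fastforce
    qed
    have const: "Q w = f 0" if nz: "noisy_copy t w \<noteq> 0" for w
    proof -
      obtain y z where "w = (2 * y + z, y, z)" "y < 2" "z < 2"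
        using nz by (cases w) (auto simp: noisy_copy_def split: if_splits)
      \<comment> \<open>The pairs \<open>(y, z)\<close> and \<open>(0, z)\<close> share the value
        \<open>f' z\<close>.\<close>
      then show ?thesis using Q[of y z] Q[of 0 z] by simp
    qed
    \<comment> \<open>Here \<open>\<kappa>\<close> is the law of the constant
      \<open>f 0\<close>.\<close>
    show ?thesis unfolding v
    proof (rule mutual_info_eq_0I[where \<kappa> = "\<lambda>q. if q = f 0 then 1 else 0"])
      fix q s
      show "law outcomes (noisy_copy t) (\<lambda>w. (Q w, ?S w)) (q, s) =
        (if q = f 0 then 1 else 0) * law outcomes (noisy_copy t) ?S s"
      proof (cases "q = f 0")
        case True
        have "law outcomes (noisy_copy t) (\<lambda>w. (Q w, ?S w)) (q, s) = law outcomes (noisy_copy t) ?S s"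
          using const True by (intro law_cong) simp
        then show ?thesis using True by simp
      next
        case False
        then have "law outcomes (noisy_copy t) (\<lambda>w. (Q w, ?S w)) (q, s) = 0"
          using const unfolding law_def by (intro sum.neutral) fastforce
        then show ?thesis using False by simp
      qed
    qed (use assms P in auto)
  qed
  \<comment> \<open>The greatest value must be attained: a constant \<open>Q\<close> is admissible,
    and its value can only be 0 by the above.\<close>
  moreover have "\<exists>v. v \<in> SI_wedge_values b {..<4} {..<2} {..<2} (noisy_copy t)"
    unfolding SI_wedge_values_def
    by (intro exI CollectI exI[of _ "\<lambda>_. 0"] conjI refl) auto
  ultimately have "SI_wedge_values b {..<4} {..<2} {..<2} (noisy_copy t) = {0}" by blast
  then show ?thesis unfolding SI_wedge_def by (auto intro!: Greatest_equality)
qed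

text \<open>The choice \<open>Q = Y\<close> attains the upper bound, since \<open>Y = Z\<close>
  almost surely.\<close>

lemma SI_wedge_copy:
  assumes "b > 1"
  shows "SI_wedge b {..<4} {..<2} {..<2} (noisy_copy 0) = log b 2"
  unfolding SI_wedge_def
proof (rule Greatest_equality)
  let ?S = "\<lambda>(s, y, z). s :: nat" and ?Y = "\<lambda>(s :: nat, y, z :: nat). y :: nat"
  have P: "noisy_copy 0 \<in> prob_simplex outcomes" by (rule noisy_copy_in_simplex) auto
  have "mutual_info b outcomes (noisy_copy 0) ?Y ?S = log b 2"
  proof (rule mutual_info_eq_log_2[OF _ P assms])
    fix w assume w: "w \<in> outcomes" "noisy_copy 0 w > 0"
    \<comment> \<open>On the support \<open>y = z\<close>, so the code of \<open>S\<close> is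
      \<open>2 * y + y\<close>.\<close>
    then obtain y where y: "w = (3 * y, y, y)" "y < 2"
      by (cases w) (auto simp: noisy_copy_def split: if_splits)
    have "law outcomes (noisy_copy 0) (\<lambda>w. (?Y w, ?S w)) (y, 3 * y) = law outcomes (noisy_copy 0) ?Y y"
      by (intro law_cong) (auto simp: noisy_copy_def split: if_splits)
    moreover have "law outcomes (noisy_copy 0) ?S (3 * y) = 1 / 2"
      using y unfolding law_noisy_copy_S by (auto simp: noisy_copy_def less_2_cases_iff)
    ultimately show "law outcomes (noisy_copy 0) ?Y (?Y w) = 1 / 2 \<and>
        law outcomes (noisy_copy 0) ?S (?S w) = 1 / 2 \<and>
        law outcomes (noisy_copy 0) (\<lambda>w. (?Y w, ?S w)) (?Y w, ?S w) = 1 / 2"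
      by (simp add: y law_noisy_copy_Y)
  qed simp
  moreover have "AE (s, y, z) in dist_measure outcomes (noisy_copy 0). ?Y (s, y, z) = y \<and> ?Y (s, y, z) = z"
    unfolding dist_measure_def AE_point_measure by (auto simp: noisy_copy_def split: if_splits)
  ultimately show "log b 2 \<in> SI_wedge_values b {..<4} {..<2} {..<2} (noisy_copy 0)"
    unfolding SI_wedge_values_def
    by (intro CollectI exI[of _ ?Y] exI[of _ "\<lambda>y. y"]) simp
  show "v \<le> log b 2" if "v \<in> SI_wedge_values b {..<4} {..<2} {..<2} (noisy_copy 0)" for v
    using that mutual_info_le_log_2[OF _ P assms, of ?S] unfolding SI_wedge_values_def by auto
qed

section \<open>Conditionally independent extensions\<close>

text \<open>Because \<open>S\<close> determines \<open>Y\<close> and \<open>Z\<close>, the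
  constraints say that the law of \<open>Q\<close> given \<open>(y, z)\<close> equals its law given
  \<open>y\<close> and its law given \<open>z\<close>. As all pairs \<open>(y, z)\<close> occur,
  these laws are all the same.\<close>

lemma SI_GH_noisy_copy:
  assumes "b > 1" "0 < t" "t < 1"
  shows "SI_GH b {..<4} {..<2} {..<2} (noisy_copy t) = 0"
proof -
  have P: "noisy_copy t \<in> prob_simplex outcomes" using assms by (intro noisy_copy_in_simplex) auto
  let ?S = "\<lambda>(s, y, z, q). s :: nat" and ?Q = "\<lambda>(s :: nat, y :: nat, z :: nat, q). q :: nat"
    and ?Y = "\<lambda>(s :: nat, y :: nat, z :: nat, q :: nat). y"
    and ?Z = "\<lambda>(s :: nat, y :: nat, z :: nat, q :: nat). z"
  have "v = 0" if v: "v \<in> SI_GH_values b {..<4} {..<2} {..<2} (noisy_copy t)" for v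
  proof -
    obtain D :: "nat set" and R where
      v: "v = mutual_info b ({..<4} \<times> {..<2} \<times> {..<2} \<times> D) R ?Q ?S"
      and D: "finite D" and R: "R \<in> prob_simplex ({..<4} \<times> {..<2} \<times> {..<2} \<times> D)"
      and marg: "\<And>s y z. s \<in> {..<4} \<Longrightarrow> y \<in> {..<2} \<Longrightarrow> z \<in> {..<2} \<Longrightarrow>
        (\<Sum>q\<in>D. R (s, y, z, q)) = noisy_copy t (s, y, z)"
      and SQY: "cond_mutual_info b ({..<4} \<times> {..<2} \<times> {..<2} \<times> D) R ?S ?Q ?Y = 0"
      and SQZ: "cond_mutual_info b ({..<4} \<times> {..<2} \<times> {..<2} \<times> D) R ?S ?Q ?Z = 0"
      using v unfolding SI_GH_values_def by blast
    define \<Omega> where "\<Omega> = {..<4 :: nat} \<times> {..<2 :: nat} \<times> {..<2 :: nat} \<times> D"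
    have fin: "finite \<Omega>" using D by (simp add: \<Omega>_def)
    have marginal: "law \<Omega> R (\<lambda>(s, y, z, q). X s y z) x = law outcomes (noisy_copy t) (\<lambda>(s, y, z). X s y z) x"
      for X :: "nat \<Rightarrow> nat \<Rightarrow> nat \<Rightarrow> nat" and x
      unfolding \<Omega>_def by (rule law_marginal[OF marg])
    note R = R[folded \<Omega>_def] and SQY = SQY[folded \<Omega>_def] and SQZ = SQZ[folded \<Omega>_def]
    \<comment> \<open>Each \<open>R (s, y, z, q)\<close> is bounded by its marginal
      \<open>noisy_copy t (s, y, z)\<close>, so \<open>R\<close> inherits the support
      condition.\<close>
    have supp: "y = s div 2 \<and> z = s mod 2 \<and> s < 4 \<and> q \<in> D" if "R (s, y, z, q) \<noteq> 0" for s y z q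
    proof -
      have w: "(s, y, z, q) \<in> \<Omega>" using that prob_simplexD(2)[OF R] by blast
      then have "R (s, y, z, q) \<le> noisy_copy t (s, y, z)"
        unfolding marg[symmetric]
        using marg[of s y z] member_le_sum[of q D "\<lambda>q. R (s, y, z, q)"] prob_simplexD(1)[OF R] D
        by (auto simp: \<Omega>_def)
      then have "noisy_copy t (s, y, z) \<noteq> 0"
        using that prob_simplexD(1)[OF R, of "(s, y, z, q)"] by linarith
      then show ?thesis
        using w by (auto simp: noisy_copy_def \<Omega>_def split: if_splits)
    qed
    \<comment> \<open>Joint laws of \<open>Q\<close> with \<open>Y\<close> and with
      \<open>Z\<close>. As both bits are fair, \<open>2 * L y q\<close> and
      \<open>2 * L' z q\<close> are the conditional probabilities of \<open>q\<close>.\<close>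
    define L where "L y q = law \<Omega> R (\<lambda>w. (?Q w, ?Y w)) (q, y)" for q y
    define L' where "L' z q = law \<Omega> R (\<lambda>w. (?Q w, ?Z w)) (q, z)" for q z
    have S: "law \<Omega> R ?S s = noisy_copy t (s, s div 2, s mod 2)" for s
      using marginal[of "\<lambda>s y z. s" s] by (simp add: law_noisy_copy_S)
    have L: "R (2 * y + z, y, z, q) = 2 * noisy_copy t (2 * y + z, y, z) * L y q"
      "R (2 * y + z, y, z, q) = 2 * noisy_copy t (2 * y + z, y, z) * L' z q"
      if yz: "y < 2" "z < 2" and q: "q \<in> D" for y z q
    proof -
      have w: "(2 * y + z, y, z, q) \<in> \<Omega>" using yz q by (auto simp: \<Omega>_def)
      have SY_SZ: "law \<Omega> R (\<lambda>w. (?S w, ?Y w)) (2 * y + z, y) = law \<Omega> R ?S (2 * y + z)"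
        "law \<Omega> R (\<lambda>w. (?S w, ?Z w)) (2 * y + z, z) = law \<Omega> R ?S (2 * y + z)"
        using yz by (intro law_cong; auto dest!: supp)+
      have Y_Z: "law \<Omega> R ?Y y = 1 / 2" "law \<Omega> R ?Z z = 1 / 2"
        using marginal[of "\<lambda>s y z. y" y] marginal[of "\<lambda>s y z. z" z] yz
        by (simp_all add: law_noisy_copy_Y law_noisy_copy_Z)
      have SQY_SQZ: "law \<Omega> R (\<lambda>w. (?S w, ?Q w, ?Y w)) (2 * y + z, q, y) = R (2 * y + z, y, z, q)"
        "law \<Omega> R (\<lambda>w. (?S w, ?Q w, ?Z w)) (2 * y + z, q, z) = R (2 * y + z, y, z, q)"
        using yz by (intro law_eq_outcome[OF fin w]; auto dest!: supp)+
      have div_mod: "(2 * y + z) div 2 = y" "(2 * y + z) mod 2 = z" using yz by auto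
      show "R (2 * y + z, y, z, q) = 2 * noisy_copy t (2 * y + z, y, z) * L y q"
        "R (2 * y + z, y, z, q) = 2 * noisy_copy t (2 * y + z, y, z) * L' z q"
        using SQY[unfolded cond_mutual_info_eq_0_iff[OF fin R assms(1)],
            rule_format, of "2 * y + z" q y]
          SQZ[unfolded cond_mutual_info_eq_0_iff[OF fin R assms(1)],
            rule_format, of "2 * y + z" q z]
        unfolding SY_SZ Y_Z SQY_SQZ S div_mod L_def L'_def by simp_all
    qed
    have "L y q = L' z q" if "y < 2" "z < 2" "q \<in> D" for y z q
    proof -
      have "noisy_copy t (2 * y + z, y, z) > 0" using assms that by (auto simp: noisy_copy_def)
      then show ?thesis using L[OF that] by simp
    qed
    \<comment> \<open>\<open>L y q\<close> and \<open>L 0 q\<close> agree with a common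
      \<open>L' z q\<close>.\<close>
    then have const: "L y q = L 0 q" if "y < 2" "q \<in> D" for y q
      using that by (metis zero_less_numeral)
    show ?thesis unfolding v \<Omega>_def[symmetric]
    proof (rule mutual_info_eq_0I[where \<kappa> = "\<lambda>q. 2 * L 0 q", OF fin R assms(1)])
      fix q s assume "q \<in> ?Q ` \<Omega>" "s \<in> ?S ` \<Omega>"
      then have qs: "q \<in> D" "s < 4" by (auto simp: \<Omega>_def)
      then have y: "s div 2 < 2" by auto
      have "(s, s div 2, s mod 2, q) \<in> \<Omega>" using qs y by (auto simp: \<Omega>_def)
      then have "law \<Omega> R (\<lambda>w. (?Q w, ?S w)) (q, s) = R (s, s div 2, s mod 2, q)"
        by (intro law_eq_outcome[OF fin]) (auto dest!: supp)
      also have "\<dots> = 2 * L 0 q * law \<Omega> R ?S s"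
        using L(1)[of "s div 2" "s mod 2" q] const[OF y qs(1)] y qs by (simp add: S)
      finally show "law \<Omega> R (\<lambda>w. (?Q w, ?S w)) (q, s) = 2 * L 0 q * law \<Omega> R ?S s" .
    qed
  qed
  moreover have "\<exists>v. v \<in> SI_GH_values b {..<4} {..<2} {..<2} (noisy_copy t)"
  proof -
    \<comment> \<open>The trivial extension by a constant \<open>Q\<close> shows that the set of
      values is nonempty.\<close>
    define R where "R = (\<lambda>(s, y, z, q :: nat). if q = 0 then noisy_copy t (s, y, z) else 0)"
    let ?\<Omega> = "{..<4} \<times> {..<2} \<times> {..<2} \<times> {0 :: nat}"
    have R: "R \<in> prob_simplex ?\<Omega>"
      using P by (auto simp: R_def prob_simplex_def sum.cartesian_product')
    have "cond_mutual_info b ?\<Omega> R ?S ?Q ?Y = 0" "cond_mutual_info b ?\<Omega> R ?S ?Q ?Z = 0"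
      by (rule cond_mutual_info_eq_0I[OF _ R assms(1), where h = "\<lambda>_. 0"]; auto)+
    with R show ?thesis
      unfolding SI_GH_values_def by (intro exI CollectI exI[of _ "{0}"] exI[of _ R]) (auto simp: R_def)
  qed
  ultimately have "SI_GH_values b {..<4} {..<2} {..<2} (noisy_copy t) = {0}" by blast
  then show ?thesis unfolding SI_GH_def by (auto intro!: Greatest_equality)
qed

text \<open>The upper bound is attained by letting \<open>Q\<close> copy \<open>Y\<close>. On the
  support \<open>Q\<close> is then also equal to \<open>Z\<close>, so both conditional informations
  vanish.\<close>

lemma SI_GH_copy:
  assumes "b > 1"
  shows "SI_GH b {..<4} {..<2} {..<2} (noisy_copy 0) = log b 2"
  unfolding SI_GH_def
proof (rule Greatest_equality)
  let ?S = "\<lambda>(s, y, z, q). s :: nat" and ?Q = "\<lambda>(s :: nat, y :: nat, z :: nat, q). q :: nat"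
    and ?Y = "\<lambda>(s :: nat, y :: nat, z :: nat, q :: nat). y"
    and ?Z = "\<lambda>(s :: nat, y :: nat, z :: nat, q :: nat). z"
  have P: "noisy_copy 0 \<in> prob_simplex outcomes" by (rule noisy_copy_in_simplex) auto
  define R where "R = (\<lambda>(s, y, z, q). if q = y then noisy_copy 0 (s, y, z) else 0)"
  let ?\<Omega> = "{..<4} \<times> {..<2} \<times> {..<2} \<times> {..<2 :: nat}"
  have marg: "(\<Sum>q<2. R (s, y, z, q)) = noisy_copy 0 (s, y, z)" if "y \<in> {..<2}" for s y z
    using that by (simp add: R_def)
  have R: "R \<in> prob_simplex ?\<Omega>"
    using P by (auto simp: prob_simplex_def sum.cartesian_product' marg) (auto simp: R_def)
  have marginal: "law ?\<Omega> R (\<lambda>(s, y, z, q). X s y z) x = law outcomes (noisy_copy 0) (\<lambda>(s, y, z). X s y z) x"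
    for X :: "nat \<Rightarrow> nat \<Rightarrow> nat \<Rightarrow> nat" and x
    by (rule law_marginal[OF marg])
  have supp: "s = 3 * y \<and> z = y \<and> q = y \<and> y < 2" if "R (s, y, z, q) \<noteq> 0" for s y z q
    using that by (auto simp: R_def noisy_copy_def split: if_splits)
  have "cond_mutual_info b ?\<Omega> R ?S ?Q ?Y = 0" "cond_mutual_info b ?\<Omega> R ?S ?Q ?Z = 0"
    by (rule cond_mutual_info_eq_0I[OF _ R assms(1), where h = "\<lambda>y. y"]; auto dest!: supp)+
  moreover have "mutual_info b ?\<Omega> R ?Q ?S = log b 2"
  proof (rule mutual_info_eq_log_2[OF _ R assms])
    fix w assume w: "w \<in> ?\<Omega>" "R w > 0"
    obtain y where y: "w = (3 * y, y, y, y)" "y < 2"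
    proof (cases w)
      case (fields s y z q)
      then show ?thesis using supp[of s y z q] w(2) by (intro that[of y]) auto
    qed
    have "law ?\<Omega> R (\<lambda>w. (?Q w, ?S w)) (y, 3 * y) = law ?\<Omega> R ?Y y" "law ?\<Omega> R ?Q y = law ?\<Omega> R ?Y y"
      by (intro law_cong; auto dest!: supp)+
    moreover have "law ?\<Omega> R ?Y y = 1 / 2"
      using marginal[of "\<lambda>s y z. y" y] y(2)
      by (simp add: law_noisy_copy_Y)
    moreover have "law ?\<Omega> R ?S (3 * y) = 1 / 2"
      using marginal[of "\<lambda>s y z. s" "3 * y"] y(2)
      unfolding law_noisy_copy_S by (auto simp: noisy_copy_def less_2_cases_iff)
    ultimately show "law ?\<Omega> R ?Q (?Q w) = 1 / 2 \<and> law ?\<Omega> R ?S (?S w) = 1 / 2 \<and>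
        law ?\<Omega> R (\<lambda>w. (?Q w, ?S w)) (?Q w, ?S w) = 1 / 2"
      by (simp add: y)
  qed simp
  ultimately show "log b 2 \<in> SI_GH_values b {..<4} {..<2} {..<2} (noisy_copy 0)"
    unfolding SI_GH_values_def using R marg
    by (intro CollectI exI[of _ "{..<2}"] exI[of _ R]) simp
  show "v \<le> log b 2" if v: "v \<in> SI_GH_values b {..<4} {..<2} {..<2} (noisy_copy 0)" for v
  proof -
    obtain D :: "nat set" and R where
      v: "v = mutual_info b ({..<4} \<times> {..<2} \<times> {..<2} \<times> D) R ?Q ?S"
      and D: "finite D" and R: "R \<in> prob_simplex ({..<4} \<times> {..<2} \<times> {..<2} \<times> D)"
      and marg: "\<And>s y z. s \<in> {..<4} \<Longrightarrow> y \<in> {..<2} \<Longrightarrow> z \<in> {..<2} \<Longrightarrow>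
        (\<Sum>q\<in>D. R (s, y, z, q)) = noisy_copy 0 (s, y, z)"
      using v unfolding SI_GH_values_def by blast
    show ?thesis
      unfolding v using D R assms by (intro mutual_info_le_log_2 law_marginal marg) auto
  qed
qed

section \<open>Channels from \<open>Y\<close> and from \<open>Z\<close> with the same output
  law\<close>

text \<open>The output probabilities of the channel sum to 1 for each input, so summing
  \<open>R\<close> over \<open>q\<close> recovers the law of \<open>S\<close>.\<close>

lemma law_star_S:
  assumes "finite D" "stochastic_matrix {..<2} D k"
    and "\<And>s q. s < 4 \<Longrightarrow> q \<in> D \<Longrightarrow> R (s, q) = (\<Sum>y<2. (\<Sum>z<2. noisy_copy t (s, y, z)) * k q y)"
  shows "law ({..<4} \<times> D) R fst s = law outcomes (noisy_copy t) (\<lambda>(s, y, z). s) s"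
proof (cases "s < 4")
  case True
  have "law ({..<4} \<times> D) R fst s = (\<Sum>s'<4. \<Sum>q\<in>D. if s' = s then R (s, q) else 0)"
    unfolding law_def sum.cartesian_product' by (intro sum.cong) auto
  also have "\<dots> = (\<Sum>s'<4. if s' = s then \<Sum>q\<in>D. R (s, q) else 0)"
    by (intro sum.cong) auto
  also have "\<dots> = (\<Sum>q\<in>D. \<Sum>y<2. (\<Sum>z<2. noisy_copy t (s, y, z)) * k q y)"
    using True by (simp add: assms(3))
  also have "\<dots> = (\<Sum>y<2. (\<Sum>z<2. noisy_copy t (s, y, z)) * (\<Sum>q\<in>D. k q y))"
    unfolding sum_distrib_left by (rule sum.swap)
  also have "\<dots> = (\<Sum>y<2. \<Sum>z<2. noisy_copy t (s, y, z))"
    using assms(2) by (auto simp: stochastic_matrix_def intro!: sum.cong)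
  also have "\<dots> = noisy_copy t (s, s div 2, s mod 2)"
    using True unfolding less_4_cases by (auto simp: sum_lessThan_2 noisy_copy_def)
  finally show ?thesis by (simp add: law_noisy_copy_S)
next
  case False
  then have "law ({..<4} \<times> D) R fst s = 0" by (auto simp: law_def intro!: sum.neutral)
  with False show ?thesis unfolding law_noisy_copy_S by (auto simp: noisy_copy_def)
qed

lemma law_snd_fst:
  assumes "finite A" "finite D" "s \<in> A" "q \<in> D"
  shows "law (A \<times> D) R (\<lambda>w. (snd w, fst w)) (q, s) = R (s, q)"
  using assms by (intro law_eq_outcome) auto

text \<open>Each \<open>s\<close> is compatible with a single \<open>y\<close> and a single
  \<open>z\<close>, so \<open>R (s, q)\<close> is the mass of \<open>s\<close> times
  \<open>k q y\<close> and also times \<open>k' q z\<close>. The masses are positive, so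
  \<open>k q y\<close> does not depend on \<open>y\<close>.\<close>

lemma SI_star_noisy_copy:
  assumes "b > 1" "0 < t" "t < 1"
  shows "SI_star b {..<4} {..<2} {..<2} (noisy_copy t) = 0"
proof -
  have P: "noisy_copy t \<in> prob_simplex outcomes" using assms by (intro noisy_copy_in_simplex) auto
  have "v = 0" if v: "v \<in> SI_star_values b {..<4} {..<2} {..<2} (noisy_copy t)" for v
  proof -
    obtain D :: "nat set" and R k k' where v: "v = mutual_info b ({..<4} \<times> D) R snd fst"
      and D: "finite D" and R: "R \<in> prob_simplex ({..<4} \<times> D)"
      and k: "stochastic_matrix {..<2} D k" "stochastic_matrix {..<2} D k'"
      and eq: "\<forall>s\<in>{..<4}. \<forall>q\<in>D.
           R (s, q) = (\<Sum>y<2. (\<Sum>z<2. noisy_copy t (s, y, z)) * k q y) \<and>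
           R (s, q) = (\<Sum>z<2. (\<Sum>y<2. noisy_copy t (s, y, z)) * k' q z)"
      using v unfolding SI_star_values_def by blast
    have fin: "finite ({..<4 :: nat} \<times> D)" using D by simp
    have S: "law ({..<4} \<times> D) R fst s = noisy_copy t (s, s div 2, s mod 2)" for s
      using law_star_S[OF D k(1), of R t s] eq by (simp add: law_noisy_copy_S)
    have "R (s, q) = k q 0 * law ({..<4} \<times> D) R fst s" if "q \<in> D" "s < 4" for q s
    proof -
      note E = eq[unfolded sum_lessThan_2, rule_format, of _ q]
      \<comment> \<open>The codes 0 and 2 stand for \<open>(0, 0)\<close> and \<open>(1, 0)\<close>;
        both have \<open>z = 0\<close>, so both inputs of \<open>k\<close> are compared with
        \<open>k' q 0\<close>.\<close>
      have "(1 - t) / 2 * k q 0 = (1 - t) / 2 * k' q 0" "t / 2 * k q 1 = t / 2 * k' q 0"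
        using E[of 0] E[of 2] that(1) by (auto simp: noisy_copy_def)
      then have "k q 1 = k q 0" using assms by simp
      then show ?thesis
        using E[of s] that unfolding S by (auto simp: less_4_cases noisy_copy_def)
    qed
    then have "law ({..<4} \<times> D) R (\<lambda>w. (snd w, fst w)) (q, s) = k q 0 * law ({..<4} \<times> D) R fst s"
      if "q \<in> snd ` ({..<4 :: nat} \<times> D)" "s \<in> fst ` ({..<4 :: nat} \<times> D)" for q s
      using that D by (subst law_snd_fst) force+
    then show ?thesis
      unfolding v by (rule mutual_info_eq_0I[where \<kappa> = "\<lambda>q. k q 0", OF fin R assms(1)])
  qed
  moreover have "\<exists>v. v \<in> SI_star_values b {..<4} {..<2} {..<2} (noisy_copy t)"
  proof -
    \<comment> \<open>Both channels send every input to the single output 0.\<close>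
    define R where "R = (\<lambda>(s, q :: nat). if q = 0 then noisy_copy t (s, s div 2, s mod 2) else 0)"
    have R: "R \<in> prob_simplex ({..<4} \<times> {0})"
      using assms by (auto simp: R_def prob_simplex_def sum.cartesian_product' sum_lessThan_4 noisy_copy_def)
    moreover have "stochastic_matrix {..<2} {0} (\<lambda>_ _. 1)"
      by (simp add: stochastic_matrix_def)
    moreover have "\<forall>s\<in>{..<4}. \<forall>q\<in>{0}.
           R (s, q) = (\<Sum>y<2. (\<Sum>z<2. noisy_copy t (s, y, z)) * 1) \<and>
           R (s, q) = (\<Sum>z<2. (\<Sum>y<2. noisy_copy t (s, y, z)) * 1)"
      by (auto simp: R_def sum_lessThan_2 noisy_copy_def less_4_cases)
    ultimately show ?thesis
      unfolding SI_star_values_def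
      by (intro exI CollectI exI[of _ "{0}"] exI[of _ R] exI[of _ "\<lambda>_ _. 1"] conjI refl) auto
  qed
  ultimately have "SI_star_values b {..<4} {..<2} {..<2} (noisy_copy t) = {0}" by blast
  then show ?thesis unfolding SI_star_def by (auto intro!: Greatest_equality)
qed

text \<open>The identity channel on both sides attains the upper bound: only \<open>y = z\<close>
  has positive mass, so both channels give the joint law of \<open>S\<close> and the common
  bit.\<close>

lemma SI_star_copy:
  assumes "b > 1"
  shows "SI_star b {..<4} {..<2} {..<2} (noisy_copy 0) = log b 2"
  unfolding SI_star_def
proof (rule Greatest_equality)
  define R where "R = (\<lambda>(s, q). noisy_copy 0 (s, q, q))"
  let ?k = "\<lambda>q y :: nat. of_bool (q = y) :: real"
  have R: "R \<in> prob_simplex ({..<4} \<times> {..<2})"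
    by (auto simp: R_def prob_simplex_def sum.cartesian_product' sum_lessThan_4 sum_lessThan_2 noisy_copy_def)
  have k: "stochastic_matrix {..<2} {..<2} ?k"
    by (auto simp: stochastic_matrix_def sum_lessThan_2 less_2_cases_iff)
  have eq: "\<forall>s\<in>{..<4}. \<forall>q\<in>{..<2}.
      R (s, q) = (\<Sum>y<2. (\<Sum>z<2. noisy_copy 0 (s, y, z)) * ?k q y) \<and>
      R (s, q) = (\<Sum>z<2. (\<Sum>y<2. noisy_copy 0 (s, y, z)) * ?k q z)"
    by (auto simp: R_def sum_lessThan_2 noisy_copy_def less_2_cases_iff) presburger
  have "log b 2 = mutual_info b ({..<4} \<times> {..<2}) R snd fst"
  proof (rule mutual_info_eq_log_2[OF _ R assms, symmetric])
    fix w assume w: "w \<in> {..<4} \<times> {..<2 :: nat}" "R w > 0"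
    then obtain q where q: "w = (3 * q, q)" "q < 2"
      by (cases w) (auto simp: R_def noisy_copy_def split: if_splits)
    have "law ({..<4} \<times> {..<2}) R (\<lambda>w. (snd w, fst w)) (q, 3 * q) = 1 / 2"
      using q by (subst law_snd_fst) (auto simp: R_def noisy_copy_def)
    moreover have "law ({..<4} \<times> {..<2}) R fst (3 * q) = 1 / 2" "law ({..<4} \<times> {..<2}) R snd q = 1 / 2"
      using q by (auto simp: less_2_cases_iff law_def R_def noisy_copy_def sum.cartesian_product'
          sum_lessThan_4 sum_lessThan_2)
    ultimately show "law ({..<4} \<times> {..<2}) R snd (snd w) = 1 / 2 \<and>
        law ({..<4} \<times> {..<2}) R fst (fst w) = 1 / 2 \<and>
        law ({..<4} \<times> {..<2}) R (\<lambda>w. (snd w, fst w)) (snd w, fst w) = 1 / 2"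
      by (simp add: q)
  qed simp
  then show "log b 2 \<in> SI_star_values b {..<4} {..<2} {..<2} (noisy_copy 0)"
    unfolding SI_star_values_def using R k eq
    by (intro CollectI exI[of _ "{..<2}"] exI[of _ R] exI[of _ ?k] conjI finite_lessThan) assumption+
  show "v \<le> log b 2" if v: "v \<in> SI_star_values b {..<4} {..<2} {..<2} (noisy_copy 0)" for v
  proof -
    obtain D :: "nat set" and R k where v: "v = mutual_info b ({..<4} \<times> D) R snd fst"
      and D: "finite D" and R: "R \<in> prob_simplex ({..<4} \<times> D)"
      and k: "stochastic_matrix {..<2} D k"
      and eq: "\<forall>s\<in>{..<4}. \<forall>q\<in>D. R (s, q) = (\<Sum>y<2. (\<Sum>z<2. noisy_copy 0 (s, y, z)) * k q y)"
      using v unfolding SI_star_values_def by blast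
    show ?thesis
      unfolding v using D R assms k eq by (intro mutual_info_le_log_2 law_star_S) auto
  qed
qed

section \<open>Discontinuity of the three measures at \<open>t = 0\<close>\<close>

theorem lemma4:
  fixes b :: real
  assumes "b > 1"
  shows "(\<exists>(A :: nat set) (B :: nat set) (C :: nat set). finite A \<and> finite B \<and> finite C \<and>
            \<not> continuous_on (prob_simplex (A \<times> B \<times> C)) (SI_star b A B C)) \<and>
         (\<exists>(A :: nat set) (B :: nat set) (C :: nat set). finite A \<and> finite B \<and> finite C \<and>
            \<not> continuous_on (prob_simplex (A \<times> B \<times> C)) (SI_wedge b A B C)) \<and>
         (\<exists>(A :: nat set) (B :: nat set) (C :: nat set). finite A \<and> finite B \<and> finite C \<and>
            \<not> continuous_on (prob_simplex (A \<times> B \<times> C)) (SI_GH b A B C))"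
proof -
  have "log b 2 \<noteq> 0" using assms zero_less_log_cancel_iff[of b 2] by linarith
  then have "\<not> continuous_on (prob_simplex outcomes) (SI_star b {..<4} {..<2} {..<2})"
    "\<not> continuous_on (prob_simplex outcomes) (SI_wedge b {..<4} {..<2} {..<2})"
    "\<not> continuous_on (prob_simplex outcomes) (SI_GH b {..<4} {..<2} {..<2})"
    using assms by (intro not_continuous_noisy_copy;
      simp add: SI_star_copy SI_wedge_copy SI_GH_copy
        SI_star_noisy_copy SI_wedge_noisy_copy SI_GH_noisy_copy)+
  then show ?thesis by (intro conjI exI[of _ "{..<4}"] exI[of _ "{..<2}"]) auto
qed

end
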